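(* Let $(b,c)$ be a locally finite, connected graph over a countable set $X$, and let $G$ be a nilpotent group acting cocompactly on $X$ such that $H_{b,c}$ is $G$-invariant. Fix $x_0\in X$, let $\mathcal{K}$ be the closure in $C(X)$ of $\{f\in\mathcal{H}^+ : f(x_0)=1\}$ and let $\mathcal{M}=\{f\in\mathcal{K}: f \text{ is multiplicative}\}$. Then $\mathcal{M}=\mathrm{ex}\,\mathcal{K}$, the set of extreme points of $\mathcal{K}$.
   Context: $X$ is a countable set. A graph over $X$ is a pair $(b,c)$ with $b:X\times X\to[0,\infty)$ and $c:X\to\mathbb{R}$ such that $\sum_{y}b(x,y)<\infty$ for all $x$ ($b$ need not be symmetric). It is locally finite if each $x$ has only finitely many $y$ with $b(x,y)>0$, and connected if for all $x,z\in X$ there is a finite sequence $x=y_1,\dots,y_n=z$ with $b(y_i,y_{i+1})>0$. $C(X)$ is the space of real functions on $X$ with the product topology. $\mathrm{Dom}(H)=\{f:\sum_y b(x,y)|f(y)|<\infty\ \forall x\}$, $H_{b,c}f(x)=\sum_y b(x,y)(f(x)-f(y))+c(x)f(x)$; $f$ is harmonic if $Hf=0$, and $\mathcal{H}^+$ is the set of nonnegative, nonzero harmonic functions. For $G$ acting on $X$, $T_gf(x)=f(g^{-1}x)$; the action is cocompact if $GV=X$ for some finite $V$; $H$ is $G$-invariant if $T_g(\mathrm{Dom}(H))\subseteq\mathrm{Dom}(H)$ and $HT_g=T_gH$ for all $g\in G$. $f$ is multiplicative if there is a homomorphism $\gamma:G\to(0,\infty)$ with $T_gf=\gamma(g^{-1})f$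 for all $g\in G$. *)

theory Defs
  imports "HOL-Analysis.Analysis" "HOL-Algebra.Group_Action" "HOL-Algebra.Generated_Groups"
begin

text \<open>A graph over the countable type 'x (X = UNIV): weights b and potential c.\<close>
definition graph :: "('x \<Rightarrow> 'x \<Rightarrow> real) \<Rightarrow> ('x \<Rightarrow> real) \<Rightarrow> bool" where
  "graph b c \<longleftrightarrow> (\<forall>x y. b x y \<ge> 0) \<and> (\<forall>x. (\<lambda>y. b x y) summable_on UNIV)"

definition locally_finite_graph :: "('x \<Rightarrow> 'x \<Rightarrow> real) \<Rightarrow> bool" where
  "locally_finite_graph b \<longleftrightarrow> (\<forall>x. finite {y. b x y > 0})"

definition connected_graph :: "('x \<Rightarrow> 'x \<Rightarrow> real) \<Rightarrow> bool" where
  "connected_graph b \<longleftrightarrow> (\<forall>x z. (\<lambda>u v. b u v > 0)\<^sup>*\<^sup>* x z)"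

definition domH :: "('x \<Rightarrow> 'x \<Rightarrow> real) \<Rightarrow> ('x \<Rightarrow> real) set" where
  "domH b = {f. \<forall>x. (\<lambda>y. b x y * \<bar>f y\<bar>) summable_on UNIV}"

definition Hop :: "('x \<Rightarrow> 'x \<Rightarrow> real) \<Rightarrow> ('x \<Rightarrow> real) \<Rightarrow> ('x \<Rightarrow> real) \<Rightarrow> ('x \<Rightarrow> real)" where
  "Hop b c f = (\<lambda>x. (\<Sum>\<^sub>\<infinity>y. b x y * (f x - f y)) + c x * f x)"

definition harmonic :: "('x \<Rightarrow> 'x \<Rightarrow> real) \<Rightarrow> ('x \<Rightarrow> real) \<Rightarrow> ('x \<Rightarrow> real) \<Rightarrow> bool" where
  "harmonic b c f \<longleftrightarrow> f \<in> domH b \<and> Hop b c f = (\<lambda>_. 0)"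

definition posharm :: "('x \<Rightarrow> 'x \<Rightarrow> real) \<Rightarrow> ('x \<Rightarrow> real) \<Rightarrow> ('x \<Rightarrow> real) set" where
  "posharm b c = {f. harmonic b c f \<and> (\<forall>x. f x \<ge> 0) \<and> f \<noteq> (\<lambda>_. 0)}"

definition Tact :: "('g, 'm) monoid_scheme \<Rightarrow> ('g \<Rightarrow> 'x \<Rightarrow> 'x) \<Rightarrow> 'g \<Rightarrow> ('x \<Rightarrow> real) \<Rightarrow> ('x \<Rightarrow> real)" where
  "Tact G \<phi> g f = (\<lambda>x. f (\<phi> (inv\<^bsub>G\<^esub> g) x))"

definition cocompact_action :: "('g, 'm) monoid_scheme \<Rightarrow> ('g \<Rightarrow> 'x \<Rightarrow> 'x) \<Rightarrow> bool" where
  "cocompact_action G \<phi> \<longleftrightarrow> (\<exists>V. finite V \<and> (\<Union>g\<in>carrier G. \<phi> g ` V) = UNIV)"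

definition G_invariant :: "('g, 'm) monoid_scheme \<Rightarrow> ('g \<Rightarrow> 'x \<Rightarrow> 'x)
    \<Rightarrow> ('x \<Rightarrow> 'x \<Rightarrow> real) \<Rightarrow> ('x \<Rightarrow> real) \<Rightarrow> bool" where
  "G_invariant G \<phi> b c \<longleftrightarrow> (\<forall>g\<in>carrier G.
      Tact G \<phi> g ` domH b \<subseteq> domH b \<and>
      (\<forall>f\<in>domH b. Hop b c (Tact G \<phi> g f) = Tact G \<phi> g (Hop b c f)))"

definition multiplicative :: "('g, 'm) monoid_scheme \<Rightarrow> ('g \<Rightarrow> 'x \<Rightarrow> 'x) \<Rightarrow> ('x \<Rightarrow> real) \<Rightarrow> bool" where
  "multiplicative G \<phi> f \<longleftrightarrow> (\<exists>\<gamma> :: 'g \<Rightarrow> real.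
      (\<forall>g\<in>carrier G. \<gamma> g > 0) \<and>
      (\<forall>g\<in>carrier G. \<forall>h\<in>carrier G. \<gamma> (g \<otimes>\<^bsub>G\<^esub> h) = \<gamma> g * \<gamma> h) \<and>
      (\<forall>g\<in>carrier G. Tact G \<phi> g f = (\<lambda>x. \<gamma> (inv\<^bsub>G\<^esub> g) * f x)))"

definition group_commutator :: "('g, 'm) monoid_scheme \<Rightarrow> 'g \<Rightarrow> 'g \<Rightarrow> 'g" where
  "group_commutator G x y = x \<otimes>\<^bsub>G\<^esub> y \<otimes>\<^bsub>G\<^esub> inv\<^bsub>G\<^esub> x \<otimes>\<^bsub>G\<^esub> inv\<^bsub>G\<^esub> y"

fun lower_central :: "('g, 'm) monoid_scheme \<Rightarrow> nat \<Rightarrow> 'g set" where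
  "lower_central G 0 = carrier G"
| "lower_central G (Suc n) =
     generate G {group_commutator G x y | x y. x \<in> carrier G \<and> y \<in> lower_central G n}"

definition nilpotent_group :: "('g, 'm) monoid_scheme \<Rightarrow> bool" where
  "nilpotent_group G \<longleftrightarrow> group G \<and> (\<exists>n. lower_central G n = {\<one>\<^bsub>G\<^esub>})"

text \<open>Extreme points of a set of real functions (same as library's extreme_point_of, which
  needs a real_vector instance that function spaces lack).\<close>
definition extreme_point_fun :: "('x \<Rightarrow> real) \<Rightarrow> ('x \<Rightarrow> real) set \<Rightarrow> bool" where
  "extreme_point_fun f S \<longleftrightarrow> f \<in> S \<and>
     (\<forall>g\<in>S. \<forall>h\<in>S. \<forall>t::real. g \<noteq> h \<and> 0 < t \<and> t < 1 \<longrightarrow>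
        f \<noteq> (\<lambda>x. t * g x + (1 - t) * h x))"

end

theory Submission
  imports Defs "HOL-Complex_Analysis.Great_Picard"
begin

text \<open>
  If \<open>f\<close> is extreme, let \<open>S\<close> be the set of those \<open>z\<close> in \<open>G\<close> for which \<open>f (u z x) = A f (u x)\<close> for all
  \<open>u\<close>, \<open>x\<close> with a constant \<open>A > 0\<close>. Suppose that all commutators of \<open>g\<close> lie in \<open>S\<close>. Then
  \<open>f (u h g x) = A f (u g h x)\<close>, so \<open>f (h^n g^n x) = A^(n^2) f (g^n h^n x)\<close>, whereas Harnack's inequality
  bounds the quotient exponentially in \<open>n\<close>; hence \<open>A = 1\<close>. Now \<open>f (g h x) = f (h g x)\<close>, and Harnack's
  inequality with cocompactness gives \<open>f \<circ> g \<le> C f\<close>; extremality yields that \<open>f \<circ> g\<close> is a multiple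
  of \<open>f\<close>, so \<open>g \<in> S\<close>. Descending along the lower central series, \<open>S = G\<close>.

  Conversely, if \<open>f\<close> is multiplicative and \<open>f = t p + (1 - t) q\<close>, then \<open>u = p / f\<close> is bounded. Suppose that
  \<open>u\<close> does not see the commutators of \<open>g\<close>, and let \<open>M = sup (u \<circ> g - u)\<close>. A pointwise limit \<open>U\<close> of translates of
  \<open>u\<close> attains this supremum, so \<open>U \<circ> g = U + M\<close> by the maximum principle, and boundedness
  of \<open>U\<close> forces \<open>M \<le> 0\<close>. Again along the lower central series, \<open>u\<close> is \<open>G\<close>-invariant; thus it attains
  its maximum and is constant.
\<close>

section \<open>Commutators and induction along the lower central series\<close>

lemma (in group) group_commutator_closed [simp]:
  "x \<in> carrier G \<Longrightarrow> y \<in> carrier G \<Longrightarrow> group_commutator G x y \<in> carrier G"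
  by (simp add: group_commutator_def)

text \<open>The form in which commutators are used below: swapping two factors costs one commutator
  on the left.\<close>

lemma (in group) group_commutator_swap:
  assumes "x \<in> carrier G" "y \<in> carrier G"
  shows "group_commutator G x y \<otimes> (y \<otimes> x) = x \<otimes> y"
proof -
  have "group_commutator G x y \<otimes> (y \<otimes> x) = x \<otimes> y \<otimes> (inv (y \<otimes> x) \<otimes> (y \<otimes> x))"
    using assms by (simp add: group_commutator_def inv_mult_group m_assoc del: l_inv r_inv)
  then show ?thesis
    using assms by (simp del: inv_mult_group)
qed

lemma (in group) lower_central_subset_carrier: "lower_central G n \<subseteq> carrier G"
proof (induction n)
  case (Suc n)
  have "{group_commutator G x y | x y. x \<in> carrier G \<and> y \<in> lower_central G n} \<subseteq> carrier G"
    using Suc by auto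
  then show ?case
    using generate_incl by simp
qed simp

text \<open>Downward induction on the index of the lower central series: for \<open>g\<close> in one
  term, all commutators of \<open>g\<close> lie in the next, and some term is trivial.\<close>

lemma nilpotent_group_induct:
  assumes nil: "nilpotent_group G"
    and one: "P \<one>\<^bsub>G\<^esub>"
    and step: "\<And>g. \<lbrakk>g \<in> carrier G; \<And>h. h \<in> carrier G \<Longrightarrow> P (group_commutator G h g)\<rbrakk> \<Longrightarrow> P g"
    and g: "g \<in> carrier G"
  shows "P g"
proof -
  interpret group G
    using nil by (simp add: nilpotent_group_def)
  obtain n where n: "lower_central G n = {\<one>\<^bsub>G\<^esub>}"
    using nil by (auto simp: nilpotent_group_def)
  have "\<forall>g \<in> lower_central G 0. P g"
  proof (rule inc_induct[of 0 n])
    show "\<forall>g \<in> lower_central G n. P g"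
      using n one by simp
  next
    fix m assume IH: "\<forall>g \<in> lower_central G (Suc m). P g"
    show "\<forall>g \<in> lower_central G m. P g"
    proof
      fix g assume g: "g \<in> lower_central G m"
      show "P g"
      proof (rule step)
        show "g \<in> carrier G"
          using g lower_central_subset_carrier by blast
        fix h assume "h \<in> carrier G"
        then have "group_commutator G h g \<in> lower_central G (Suc m)"
          using g by (auto intro!: generate.incl)
        then show "P (group_commutator G h g)"
          using IH by blast
      qed
    qed
  qed simp
  then show ?thesis
    using g by simp
qed

section \<open>Function spaces with a Harnack inequality under a cocompact action\<close>

text \<open>Isolates the properties of the space \<open>L\<close> of harmonic functions, of either
  sign, on which both inclusions rest.\<close>

locale harnack_space = group_action G UNIV \<phi>
  for G (structure) and \<phi> :: "'g \<Rightarrow> 'x::countable \<Rightarrow> 'x" +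
  fixes L :: "('x \<Rightarrow> real) set"
  assumes lincomb: "\<lbrakk>p \<in> L; q \<in> L\<rbrakk> \<Longrightarrow> (\<lambda>x. s * p x + t * q x) \<in> L"
    and pointwise_limit: "\<lbrakk>\<And>n::nat. F n \<in> L; \<And>x. (\<lambda>n. F n x) \<longlonglongrightarrow> f x\<rbrakk> \<Longrightarrow> f \<in> L"
    and translate: "\<lbrakk>g \<in> carrier G; f \<in> L\<rbrakk> \<Longrightarrow> (\<lambda>x. f (\<phi> g x)) \<in> L"
    and harnack: "\<exists>C. \<forall>f\<in>L. (\<forall>z. 0 \<le> f z) \<longrightarrow> f y \<le> C * f x"
    and cocompact: "cocompact_action G \<phi>"
begin

sublocale grp: group G
  using group_hom group_hom.axioms(1) by blast

lemma act_mult [simp]: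
  "\<lbrakk>g \<in> carrier G; h \<in> carrier G\<rbrakk> \<Longrightarrow> \<phi> (g \<otimes> h) x = \<phi> g (\<phi> h x)"
  using composition_rule[of x g h] by simp

lemma act_one [simp]: "\<phi> \<one> x = x"
  using id_eq_one by (metis UNIV_I restrict_apply')

lemma scale: "f \<in> L \<Longrightarrow> (\<lambda>x. s * f x) \<in> L"
  using lincomb[of f f s 0] by simp

text \<open>A nonnegative constant allows such bounds to be chained.\<close>

lemma harnack_nonneg:
  obtains C where "C \<ge> 0" and "\<And>f. \<lbrakk>f \<in> L; \<And>z. 0 \<le> f z\<rbrakk> \<Longrightarrow> f y \<le> C * f x"
proof -
  obtain C where C: "\<forall>f\<in>L. (\<forall>z. 0 \<le> f z) \<longrightarrow> f y \<le> C * f x"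
    using harnack by blast
  show ?thesis
  proof
    show "max C 0 \<ge> 0" by simp
    fix f assume f: "f \<in> L" "\<And>z. 0 \<le> f z"
    then have "f y \<le> C * f x"
      using C by blast
    also have "\<dots> \<le> max C 0 * f x"
      using f(2) by (intro mult_right_mono) auto
    finally show "f y \<le> max C 0 * f x" .
  qed
qed

text \<open>This serves as the maximum principle: applied to \<open>(M - u x) * f x\<close>, it
  turns an attained upper bound of \<open>u\<close> into constancy.\<close>

lemma zero_everywhere:
  assumes "f \<in> L" "\<And>z. 0 \<le> f z" "f x = 0"
  shows "f y = 0"
proof -
  obtain C where "f y \<le> C * f x"
    using harnack assms(1,2) by blast
  then show ?thesis
    using assms(2)[of y] assms(3) by simp
qed

lemma pos_everywhere:
  assumes "f \<in> L" "\<And>z. 0 \<le> f z" "f x > 0"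
  shows "f y > 0"
  using zero_everywhere[of f y x] assms by (metis less_irrefl order_le_less)

lemma fundamental_domain:
  obtains V where "finite V" "V \<noteq> {}" "\<And>x. \<exists>g\<in>carrier G. \<exists>v\<in>V. x = \<phi> g v"
proof -
  obtain V where V: "finite V" "(\<Union>g\<in>carrier G. \<phi> g ` V) = UNIV"
    using cocompact by (auto simp: cocompact_action_def)
  then have "\<exists>g\<in>carrier G. \<exists>v\<in>V. x = \<phi> g v" for x
    by blast
  with V(1) show ?thesis
    by (metis empty_iff that)
qed

section \<open>Growth along powers, and elements that commute up to a factor\<close>

text \<open>Translates of \<open>f\<close> by \<open>u \<otimes> h [^] n\<close> are again
  nonnegative members of \<open>L\<close>, so each further power of \<open>h\<close> costs the same
  Harnack constant, whatever \<open>u\<close> is.\<close>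

lemma power_upper_bound:
  assumes h: "h \<in> carrier G" and f: "f \<in> L" "\<And>z. 0 \<le> f z"
  obtains C where "C \<ge> 0" and
    "\<And>u n. u \<in> carrier G \<Longrightarrow> f (\<phi> u (\<phi> (h [^] (n::nat)) x)) \<le> C ^ n * f (\<phi> u x)"
proof -
  obtain C where C: "C \<ge> 0" "\<And>f. \<lbrakk>f \<in> L; \<And>z. 0 \<le> f z\<rbrakk> \<Longrightarrow> f (\<phi> h x) \<le> C * f x"
    using harnack_nonneg by metis
  have "f (\<phi> u (\<phi> (h [^] n) x)) \<le> C ^ n * f (\<phi> u x)"
    if u: "u \<in> carrier G" for u and n :: nat
  proof (induction n)
    case (Suc n)
    have "f (\<phi> (u \<otimes> h [^] n) (\<phi> h x)) \<le> C * f (\<phi> (u \<otimes> h [^] n) x)"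
      using f u h by (intro C(2) translate) auto
    also have "\<dots> \<le> C * (C ^ n * f (\<phi> u x))"
      using Suc C(1) u h by (intro mult_left_mono) auto
    finally show ?case
      using u h by (simp add: mult.assoc)
  qed simp
  with C(1) show ?thesis
    by (rule that)
qed

lemma power_lower_bound:
  assumes h: "h \<in> carrier G" and f: "f \<in> L" "\<And>z. 0 \<le> f z"
  obtains C where "C \<ge> 0" and
    "\<And>u n. u \<in> carrier G \<Longrightarrow> f (\<phi> u x) \<le> C ^ n * f (\<phi> u (\<phi> (h [^] (n::nat)) x))"
proof -
  obtain C where C: "C \<ge> 0" "\<And>f. \<lbrakk>f \<in> L; \<And>z. 0 \<le> f z\<rbrakk> \<Longrightarrow> f x \<le> C * f (\<phi> h x)"
    using harnack_nonneg by metis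
  have "f (\<phi> u x) \<le> C ^ n * f (\<phi> u (\<phi> (h [^] n) x))"
    if u: "u \<in> carrier G" for u and n :: nat
  proof (induction n)
    case (Suc n)
    have "f (\<phi> (u \<otimes> h [^] n) x) \<le> C * f (\<phi> (u \<otimes> h [^] n) (\<phi> h x))"
      using f u h by (intro C(2) translate) auto
    then have "C ^ n * f (\<phi> u (\<phi> (h [^] n) x)) \<le> C ^ n * (C * f (\<phi> (u \<otimes> h [^] n) (\<phi> h x)))"
      using C(1) u h by (intro mult_left_mono) auto
    with Suc show ?case
      using u h by (simp add: mult_ac)
  qed simp
  with C(1) show ?thesis
    by (rule that)
qed

text \<open>Moving \<open>n\<close> factors \<open>g\<close> past \<open>m\<close> factors
  \<open>h\<close> takes \<open>n * m\<close> swaps, each contributing \<open>A\<close>.\<close>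

lemma quasi_commute_powers:
  assumes g: "g \<in> carrier G" and h: "h \<in> carrier G" and u: "u \<in> carrier G"
    and A: "\<And>u x. u \<in> carrier G \<Longrightarrow> f (\<phi> u (\<phi> g (\<phi> h x))) = A * f (\<phi> u (\<phi> h (\<phi> g x)))"
  shows "f (\<phi> u (\<phi> (g [^] (n::nat)) (\<phi> (h [^] (m::nat)) x)))
       = (A ^ m) ^ n * (f (\<phi> u (\<phi> (h [^] m) (\<phi> (g [^] n) x))) :: real)"
proof -
  \<comment> \<open>One \<open>g\<close> passes all of \<open>h [^] m\<close>. The prefix
    \<open>u\<close> must vary, since it absorbs each \<open>h\<close> already passed.\<close>
  have right: "f (\<phi> u (\<phi> g (\<phi> (h [^] m) x))) = A ^ m * f (\<phi> u (\<phi> (h [^] m) (\<phi> g x)))"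
    if "u \<in> carrier G" for u x and m :: nat
    using that
  proof (induction m arbitrary: u)
    case (Suc m)
    have "f (\<phi> u (\<phi> g (\<phi> h (\<phi> (h [^] m) x)))) = A * f (\<phi> (u \<otimes> h) (\<phi> g (\<phi> (h [^] m) x)))"
      using A Suc.prems h by simp
    also have "\<dots> = A * (A ^ m * f (\<phi> (u \<otimes> h) (\<phi> (h [^] m) (\<phi> g x))))"
      using Suc h by (subst Suc.IH) auto
    \<comment> \<open>The power recursion splits off the last factor, but here the first one is
      passed.\<close>
    moreover have "\<phi> (h [^] Suc m) y = \<phi> h (\<phi> (h [^] m) y)" for y
      using h by (simp only: grp.nat_pow_Suc2 act_mult grp.nat_pow_closed)
    ultimately show ?case
      using Suc.prems h by simp
  qed simp
  show ?thesis
  proof (induction n arbitrary: x)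
    case (Suc n)
    have "f (\<phi> (u \<otimes> g [^] n) (\<phi> g (\<phi> (h [^] m) x)))
        = A ^ m * f (\<phi> (u \<otimes> g [^] n) (\<phi> (h [^] m) (\<phi> g x)))"
      using u g by (intro right) simp
    then show ?case
      using Suc.IH[of "\<phi> g x"] u g h by simp
  qed simp
qed

text \<open>Quadratic against linear exponents: the swaps give \<open>A\<close> to the power
  \<open>n * n\<close>, the Harnack bounds only \<open>D ^ n\<close>; taking \<open>n\<close>-th
  roots, \<open>A ^ n\<close> stays bounded.\<close>

lemma quasi_commute_le_one:
  assumes g: "g \<in> carrier G" and h: "h \<in> carrier G"
    and f: "f \<in> L" "\<And>x. f x > 0"
    and A: "\<And>u x. u \<in> carrier G \<Longrightarrow> f (\<phi> u (\<phi> g (\<phi> h x))) = A * f (\<phi> u (\<phi> h (\<phi> g x)))"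
    and "A > 0"
  shows "A \<le> 1"
proof (rule ccontr)
  assume "\<not> A \<le> 1"
  fix x :: 'x
  have f0: "\<And>x. 0 \<le> f x"
    using f(2) less_imp_le by blast
  obtain Cg where Cg: "Cg \<ge> 0" "\<And>u n. u \<in> carrier G \<Longrightarrow>
      f (\<phi> u (\<phi> (g [^] (n::nat)) x)) \<le> Cg ^ n * f (\<phi> u x)"
    using power_upper_bound[OF g f(1) f0] by blast
  obtain Ch where Ch: "Ch \<ge> 0" "\<And>u n. u \<in> carrier G \<Longrightarrow>
      f (\<phi> u (\<phi> (h [^] (n::nat)) x)) \<le> Ch ^ n * f (\<phi> u x)"
    using power_upper_bound[OF h f(1) f0] by blast
  obtain Dg where Dg: "Dg \<ge> 0" "\<And>u n. u \<in> carrier G \<Longrightarrow>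
      f (\<phi> u x) \<le> Dg ^ n * f (\<phi> u (\<phi> (g [^] (n::nat)) x))"
    using power_lower_bound[OF g f(1) f0] by blast
  obtain Dh where Dh: "Dh \<ge> 0" "\<And>u n. u \<in> carrier G \<Longrightarrow>
      f (\<phi> u x) \<le> Dh ^ n * f (\<phi> u (\<phi> (h [^] (n::nat)) x))"
    using power_lower_bound[OF h f(1) f0] by blast
  define D where "D = Ch * Cg * Dh * Dg"
  have "D \<ge> 0"
    using Cg Ch Dg Dh by (simp add: D_def)
  have bound: "A ^ n \<le> D" if "n > 0" for n
  proof -
    let ?p = "f (\<phi> (g [^] n) (\<phi> (h [^] n) x))" and ?q = "f (\<phi> (h [^] n) (\<phi> (g [^] n) x))"
    have "(A ^ n) ^ n * ?q = ?p"
      using quasi_commute_powers[of g h \<one> f A n n x] g h A by simp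
    \<comment> \<open>The chain of bounds runs through \<open>x\<close>: remove
      \<open>h [^] n\<close>, then \<open>g [^] n\<close>, then insert \<open>h [^] n\<close> and
      \<open>g [^] n\<close> in the opposite order.\<close>
    also have "\<dots> \<le> Ch ^ n * f (\<phi> (g [^] n) x)"
      using Ch(2) g by simp
    also have "\<dots> \<le> Ch ^ n * (Cg ^ n * f x)"
      using Cg(2)[of \<one> n] Ch(1) by (intro mult_left_mono) auto
    also have "\<dots> \<le> Ch ^ n * (Cg ^ n * (Dh ^ n * f (\<phi> (h [^] n) x)))"
      using Dh(2)[of \<one> n] Ch(1) Cg(1) by (intro mult_left_mono) auto
    also have "\<dots> \<le> Ch ^ n * (Cg ^ n * (Dh ^ n * (Dg ^ n * ?q)))"
      using Dg(2)[of "h [^] n" n] h Ch(1) Cg(1) Dh(1) by (intro mult_left_mono) auto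
    also have "\<dots> = D ^ n * ?q"
      by (simp add: D_def power_mult_distrib mult_ac)
    finally have "(A ^ n) ^ n \<le> D ^ n"
      using f(2) by simp
    then show ?thesis
      using power_mono_iff[of "A ^ n" D n] \<open>D \<ge> 0\<close> \<open>A > 0\<close> that by simp
  qed
  obtain n where n: "D < A ^ n"
    using real_arch_pow[of A D] \<open>\<not> A \<le> 1\<close> by auto
  \<comment> \<open>The exponent found may be 0, where \<open>bound\<close> does not apply.\<close>
  also have "\<dots> \<le> A ^ Suc n"
    using \<open>\<not> A \<le> 1\<close> \<open>A > 0\<close> by simp
  finally show False
    using bound[of "Suc n"] by simp
qed

text \<open>Exchanging the roles of \<open>g\<close> and \<open>h\<close> replaces \<open>A\<close>
  by its inverse.\<close>

lemma quasi_commute_eq_one: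
  assumes g: "g \<in> carrier G" and h: "h \<in> carrier G"
    and f: "f \<in> L" "\<And>x. f x > 0"
    and A: "\<And>u x. u \<in> carrier G \<Longrightarrow> f (\<phi> u (\<phi> g (\<phi> h x))) = A * f (\<phi> u (\<phi> h (\<phi> g x)))"
    and "A > 0"
  shows "A = 1"
proof (rule antisym)
  show "A \<le> 1"
    using quasi_commute_le_one assms by blast
  have "f (\<phi> u (\<phi> h (\<phi> g x))) = inverse A * f (\<phi> u (\<phi> g (\<phi> h x)))" if "u \<in> carrier G" for u x
    using A[OF that] \<open>A > 0\<close> by (simp add: field_simps)
  then have "inverse A \<le> 1"
    using quasi_commute_le_one[OF h g f] \<open>A > 0\<close> by simp
  then show "1 \<le> A"
    using \<open>A > 0\<close> by (simp add: field_simps)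
qed

section \<open>Extreme points are multiplicative\<close>

text \<open>Write \<open>x\<close> as \<open>h\<close> applied to \<open>v\<close> in a finite set
  \<open>V\<close>. As \<open>g\<close> and \<open>h\<close> may be swapped, Harnack's inequality
  for the translate by \<open>h\<close> compares \<open>v\<close> with its image under
  \<open>g\<close>; the constant depends on \<open>v\<close> only.\<close>

lemma translate_le_multiple:
  assumes g: "g \<in> carrier G" and f: "f \<in> L" "\<And>x. f x \<ge> 0"
    and comm: "\<And>h x. h \<in> carrier G \<Longrightarrow> f (\<phi> g (\<phi> h x)) = f (\<phi> h (\<phi> g x))"
  obtains C where "\<And>x. f (\<phi> g x) \<le> C * f x"
proof -
  obtain V where V: "finite V" "\<And>x. \<exists>g\<in>carrier G. \<exists>v\<in>V. x = \<phi> g v"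
    using fundamental_domain by metis
  have "\<exists>C. \<forall>f\<in>L. (\<forall>z. 0 \<le> f z) \<longrightarrow> f (\<phi> g v) \<le> C * f v" for v
    using harnack .
  then obtain C where C: "\<And>v f. \<lbrakk>f \<in> L; \<And>z. 0 \<le> f z\<rbrakk> \<Longrightarrow> f (\<phi> g v) \<le> C v * f v"
    by metis
  show ?thesis
  proof
    fix x
    obtain h v where h: "h \<in> carrier G" "v \<in> V" "x = \<phi> h v"
      using V(2) by blast
    have "f (\<phi> g x) = f (\<phi> h (\<phi> g v))"
      using comm h by simp
    also have "\<dots> \<le> C v * f (\<phi> h v)"
      using f h by (intro C translate) auto
    also have "\<dots> \<le> Max (C ` V) * f (\<phi> h v)"
      using V(1) h f(2) by (intro mult_right_mono) auto
    finally show "f (\<phi> g x) \<le> Max (C ` V) * f x"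
      using h by simp
  qed
qed

lemma extreme_imp_multiplicative:
  assumes nil: "nilpotent_group G"
    and extreme: "extreme_point_fun f {f \<in> L. (\<forall>x. f x \<ge> 0) \<and> f x0 = 1}"
  shows "multiplicative G \<phi> f"
proof -
  have f: "f \<in> L" "\<And>x. f x \<ge> 0" "f x0 = 1"
    using extreme by (auto simp: extreme_point_fun_def)
  have pos: "f x > 0" for x
    using pos_everywhere[of f x0] f by simp
  \<comment> \<open>Extremality yields minimality: a positive member of \<open>L\<close> dominated
    by a multiple of \<open>f\<close> is proportional to \<open>f\<close>, as it can be split off as
    a convex summand.\<close>
  have minimal: "w x = w x0 * f x"
    if w: "w \<in> L" "\<And>x. w x > 0" and C: "\<And>x. w x \<le> C * f x" for w C x
  proof -
    define \<alpha> where "\<alpha> = w x0"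
    \<comment> \<open>\<open>D \<ge> C\<close> keeps the remainder \<open>q\<close> nonnegative;
      \<open>D > \<alpha>\<close> makes the weight \<open>t\<close> less than 1.\<close>
    define D where "D = max C \<alpha> + 1"
    have "\<alpha> > 0"
      using w(2) by (simp add: \<alpha>_def)
    then have "D > 0" "D > \<alpha>" "D \<ge> C"
      by (auto simp: D_def)
    define t where "t = \<alpha> / D"
    have t: "0 < t" "t < 1"
      using \<open>\<alpha> > 0\<close> \<open>D > \<alpha>\<close> \<open>D > 0\<close> by (auto simp: t_def)
    define p where "p = (\<lambda>x. w x / \<alpha>)"
    define q where "q = (\<lambda>x. (f x - w x / D) / (1 - t))"
    have "w x \<le> D * f x" for x
      using C[of x] mult_right_mono[OF \<open>D \<ge> C\<close> f(2)[of x]] by simp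
    then have "q x \<ge> 0" for x
      using t \<open>D > 0\<close> by (simp add: q_def field_simps)
    moreover have "q \<in> L"
      using lincomb[OF f(1) w(1), of "1 / (1 - t)" "- 1 / (D * (1 - t))"]
      by (simp add: q_def diff_divide_distrib)
    moreover have "q x0 = 1"
      using t f(3) by (simp add: q_def t_def[symmetric] \<alpha>_def[symmetric])
    moreover have "p \<in> L" "p x0 = 1" "\<And>x. p x \<ge> 0"
      using scale[OF w(1), of "1 / \<alpha>"] \<open>\<alpha> > 0\<close> less_imp_le[OF w(2)] by (auto simp: p_def \<alpha>_def)
    moreover have eq: "f = (\<lambda>x. t * p x + (1 - t) * q x)"
    proof
      fix x
      have "t * p x = w x / D"
        using \<open>\<alpha> > 0\<close> by (simp add: p_def t_def)
      moreover have "(1 - t) * q x = f x - w x / D"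
        using t by (simp add: q_def)
      ultimately show "f x = t * p x + (1 - t) * q x"
        by simp
    qed
    ultimately have "p = q"
      using extreme t unfolding extreme_point_fun_def by blast
    then have "f = p"
      using eq by (auto simp: fun_eq_iff algebra_simps)
    then have "f x = w x / \<alpha>"
      by (simp add: p_def)
    then show ?thesis
      using \<open>\<alpha> > 0\<close> by (simp add: \<alpha>_def)
  qed
  \<comment> \<open>The claim includes prefixes \<open>u\<close> because the swapping argument needs
    the same factor \<open>A\<close> behind every prefix.\<close>
  have mult: "\<exists>A>0. \<forall>u\<in>carrier G. \<forall>x. f (\<phi> u (\<phi> g x)) = A * f (\<phi> u x)" if "g \<in> carrier G" for g
    using nil _ _ that
  proof (rule nilpotent_group_induct)
    show "\<exists>A>0. \<forall>u\<in>carrier G. \<forall>x. f (\<phi> u (\<phi> \<one> x)) = A * f (\<phi> u x)"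
      by (intro exI[of _ 1]) simp
  next
    fix g assume g: "g \<in> carrier G"
      and IH: "\<And>h. h \<in> carrier G \<Longrightarrow>
        \<exists>A>0. \<forall>u\<in>carrier G. \<forall>x. f (\<phi> u (\<phi> (group_commutator G h g) x)) = A * f (\<phi> u x)"
    have comm: "f (\<phi> u (\<phi> h (\<phi> g x))) = f (\<phi> u (\<phi> g (\<phi> h x)))"
      if h: "h \<in> carrier G" and "u \<in> carrier G" for u h x
    proof -
      obtain A where A: "A > 0"
        "\<And>u x. u \<in> carrier G \<Longrightarrow> f (\<phi> u (\<phi> (group_commutator G h g) x)) = A * f (\<phi> u x)"
        using IH[OF h] by blast
      have *: "f (\<phi> u (\<phi> h (\<phi> g x))) = A * f (\<phi> u (\<phi> g (\<phi> h x)))" if "u \<in> carrier G" for u x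
      proof -
        have "\<phi> h (\<phi> g x) = \<phi> (group_commutator G h g \<otimes> (g \<otimes> h)) x"
          using grp.group_commutator_swap[OF h g] g h by simp
        then show ?thesis
          using A(2)[OF that] g h by simp
      qed
      have "A = 1"
        by (rule quasi_commute_eq_one[OF h g f(1) pos * A(1)])
      then show ?thesis
        using * that by simp
    qed
    obtain C where "\<And>x. f (\<phi> g x) \<le> C * f x"
      using translate_le_multiple[OF g f(1,2)] comm[of _ \<one>] by auto
    then have eq: "f (\<phi> g x) = f (\<phi> g x0) * f x" for x
      using minimal[of "\<lambda>x. f (\<phi> g x)"] translate[OF g f(1)] pos by blast
    \<comment> \<open>Commutation brings \<open>g\<close> to the front, where \<open>eq\<close>
      applies at the point \<open>\<phi> u x\<close>.\<close>
    have "f (\<phi> u (\<phi> g x)) = f (\<phi> g x0) * f (\<phi> u x)" if "u \<in> carrier G" for u x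
      using comm[OF that, of \<one> x] eq[of "\<phi> u x"] by simp
    then show "\<exists>A>0. \<forall>u\<in>carrier G. \<forall>x. f (\<phi> u (\<phi> g x)) = A * f (\<phi> u x)"
      using pos by blast
  qed
  have eq: "f (\<phi> g x) = f (\<phi> g x0) * f x" if g: "g \<in> carrier G" for g x
  proof -
    obtain A where "\<And>x. f (\<phi> \<one> (\<phi> g x)) = A * f (\<phi> \<one> x)"
      using mult[OF g] grp.one_closed by blast
    then show ?thesis
      using f(3) by simp
  qed
  show ?thesis
    unfolding multiplicative_def
  \<comment> \<open>Since \<open>f x0 = 1\<close>, the character can be read off at
    \<open>x0\<close>.\<close>
  proof (intro exI[of _ "\<lambda>g. f (\<phi> g x0)"] conjI ballI)
    fix g h assume "g \<in> carrier G" "h \<in> carrier G"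
    then show "f (\<phi> (g \<otimes> h) x0) = f (\<phi> g x0) * f (\<phi> h x0)"
      using eq[of g "\<phi> h x0"] by simp
  next
    fix g assume "g \<in> carrier G"
    then have "inv g \<in> carrier G"
      by simp
    then show "Tact G \<phi> g f = (\<lambda>x. f (\<phi> (inv g) x0) * f x)"
      unfolding Tact_def by (rule ext[OF eq])
  qed (rule pos)
qed

section \<open>Multiplicative functions are extreme\<close>

lemma bounded_translate_le:
  assumes f: "f \<in> L" "\<And>x. f x > 0"
    and \<gamma>: "\<And>g. g \<in> carrier G \<Longrightarrow> \<gamma> g > 0" "\<And>g x. g \<in> carrier G \<Longrightarrow> f (\<phi> g x) = \<gamma> g * f x"
    and u: "(\<lambda>x. u x * f x) \<in> L" "\<And>x. \<bar>u x\<bar> \<le> B"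
    and g: "g \<in> carrier G"
    and comm: "\<And>h x. h \<in> carrier G \<Longrightarrow> u (\<phi> g (\<phi> h x)) = u (\<phi> h (\<phi> g x))"
  shows "u (\<phi> g x) \<le> u x"
proof (rule ccontr)
  assume contr: "\<not> u (\<phi> g x) \<le> u x"
  define w where "w = (\<lambda>x. u (\<phi> g x) - u x)"
  define M where "M = (SUP x. w x)"
  \<comment> \<open>Translating \<open>v * f\<close> changes \<open>f\<close> only by the factor
    \<open>\<gamma> h\<close>, which is divided out; so translates of quotients by \<open>f\<close>
    remain such quotients.\<close>
  have translate_u: "(\<lambda>x. v (\<phi> h x) * f x) \<in> L" if "h \<in> carrier G" "(\<lambda>x. v x * f x) \<in> L" for h v
    using scale[OF translate[OF that], of "1 / \<gamma> h"] \<gamma>[OF that(1)]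
    by (simp add: less_imp_neq[symmetric])
  have "w x \<le> 2 * B" for x
    using u(2)[of x] u(2)[of "\<phi> g x"] by (simp add: w_def abs_le_iff)
  then have bdd: "bdd_above (range w)"
    by (auto intro!: bdd_aboveI)
  then have wM: "w x \<le> M" for x
    by (simp add: M_def cSUP_upper)
  have "M > 0"
    using wM[of x] contr by (simp add: w_def)
  obtain V where V: "finite V" "V \<noteq> {}" "\<And>x. \<exists>g\<in>carrier G. \<exists>v\<in>V. x = \<phi> g v"
    using fundamental_domain by metis
  \<comment> \<open>The supremum is approached along a single orbit: otherwise the least of the
    finitely many gaps would lower it.\<close>
  have "\<exists>v\<in>V. \<forall>e>0. \<exists>h\<in>carrier G. M - e < w (\<phi> h v)"
  proof (rule ccontr)
    assume "\<not> ?thesis"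
    then have "\<forall>v\<in>V. \<exists>e>0. \<forall>h\<in>carrier G. w (\<phi> h v) \<le> M - e"
      by (meson not_less)
    then obtain e where e: "\<And>v. v \<in> V \<Longrightarrow> e v > 0"
      "\<And>v h. v \<in> V \<Longrightarrow> h \<in> carrier G \<Longrightarrow> w (\<phi> h v) \<le> M - e v"
      by metis
    have "w x \<le> M - Min (e ` V)" for x
    proof -
      obtain h v where h: "h \<in> carrier G" "v \<in> V" "x = \<phi> h v"
        using V(3) by blast
      have "Min (e ` V) \<le> e v"
        using V(1) h(2) by simp
      then show ?thesis
        using e(2)[OF h(2,1)] h(3) by simp
    qed
    then have "M \<le> M - Min (e ` V)"
      unfolding M_def by (intro cSUP_least) auto
    moreover have "Min (e ` V) > 0"
      using V(1,2) e(1) by simp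
    ultimately show False
      by simp
  qed
  then obtain v where v: "\<And>e. e > 0 \<Longrightarrow> \<exists>h\<in>carrier G. M - e < w (\<phi> h v)"
    by blast
  have "\<exists>h\<in>carrier G. M - inverse (real (Suc n)) < w (\<phi> h v)" for n
    by (rule v) simp
  then obtain h where h: "\<And>n. h n \<in> carrier G"
    "\<And>n. M - inverse (real (Suc n)) < w (\<phi> (h n) v)"
    by metis
  \<comment> \<open>The translates are uniformly bounded by \<open>B\<close> on a countable set, so
    a diagonal subsequence converges pointwise.\<close>
  obtain k where k: "strict_mono k" "\<And>x. \<exists>l. (\<lambda>n. u (\<phi> (h (k n)) x)) \<longlonglongrightarrow> l"
    using function_convergent_subsequence[of UNIV "\<lambda>n x. u (\<phi> (h n) x)" B] u(2)
    by (auto simp: countableI_type)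
  then obtain U where U: "\<And>x. (\<lambda>n. u (\<phi> (h (k n)) x)) \<longlonglongrightarrow> U x"
    by metis
  have UL: "(\<lambda>x. U x * f x) \<in> L"
  proof (rule pointwise_limit)
    show "(\<lambda>x. u (\<phi> (h (k n)) x) * f x) \<in> L" for n
      using translate_u h(1) u(1) by blast
    show "(\<lambda>n. u (\<phi> (h (k n)) x) * f x) \<longlonglongrightarrow> U x * f x" for x
      by (intro tendsto_intros U)
  qed
  have UB: "\<bar>U x\<bar> \<le> B" for x
    using tendsto_rabs[OF U[of x]] by (rule Lim_bounded) (use u(2) in auto)
  define W where "W = (\<lambda>x. U (\<phi> g x) - U x)"
  \<comment> \<open>By \<open>comm\<close>, translating the increment \<open>w\<close> gives the
    increment of the translate.\<close>
  have Wlim: "(\<lambda>n. w (\<phi> (h (k n)) x)) \<longlonglongrightarrow> W x" for x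
    unfolding W_def w_def using comm[OF h(1)] by (simp add: tendsto_diff[OF U U])
  have WM: "W x \<le> M" for x
    using Wlim[of x] by (rule Lim_bounded) (use wM in auto)
  have "(\<lambda>n. M - inverse (real (Suc (k n)))) \<longlonglongrightarrow> M - 0"
    using LIMSEQ_subseq_LIMSEQ[OF LIMSEQ_inverse_real_of_nat k(1)]
    by (intro tendsto_diff tendsto_const) (simp add: o_def)
  then have "M - 0 \<le> W v"
    by (rule LIMSEQ_le[OF _ Wlim]) (use h(2) less_imp_le in blast)
  then have "W v = M"
    using WM[of v] by simp
  have "(\<lambda>x. (M - W x) * f x) \<in> L"
    using lincomb[OF f(1) lincomb[OF translate_u[OF g UL] UL, of "1" "-1"], of M "-1"]
    by (simp add: W_def algebra_simps)
  then have "(M - W x) * f x = 0" for x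
    by (rule zero_everywhere[where x = v]) (auto simp: WM f(2) less_imp_le \<open>W v = M\<close>)
  then have "W x = M" for x
    using f(2)[of x] by (metis eq_iff_diff_eq_0 less_irrefl mult_eq_0_iff)
  then have step: "U (\<phi> g x) = U x + M" for x
    by (metis W_def add.commute diff_add_cancel)
  \<comment> \<open>Linear growth along the powers of \<open>g\<close> contradicts the bound
    \<open>B\<close>.\<close>
  have "U ((\<phi> g ^^ n) v) = U v + real n * M" for n
    by (induction n) (auto simp: step algebra_simps)
  moreover obtain n where "2 * B < real n * M"
    using reals_Archimedean3[OF \<open>M > 0\<close>] by blast
  ultimately show False
    using UB[of v] UB[of "(\<phi> g ^^ n) v"] by (simp add: abs_le_iff)
qed

text \<open>Once \<open>u\<close> is invariant, its values are those on a finite set meeting every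
  orbit; so it attains its maximum and the maximum principle applies.\<close>

lemma bounded_imp_constant:
  assumes nil: "nilpotent_group G"
    and f: "f \<in> L" "\<And>x. f x > 0"
    and \<gamma>: "\<And>g. g \<in> carrier G \<Longrightarrow> \<gamma> g > 0" "\<And>g x. g \<in> carrier G \<Longrightarrow> f (\<phi> g x) = \<gamma> g * f x"
    and u: "(\<lambda>x. u x * f x) \<in> L" "\<And>x. \<bar>u x\<bar> \<le> B"
  shows "u x = u y"
proof -
  have inv: "\<forall>h\<in>carrier G. \<forall>x. u (\<phi> h (\<phi> g x)) = u (\<phi> h x)" if "g \<in> carrier G" for g
    using nil _ _ that
  proof (rule nilpotent_group_induct)
    fix g assume g: "g \<in> carrier G"
      and IH: "\<And>h. h \<in> carrier G \<Longrightarrow>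
        \<forall>k\<in>carrier G. \<forall>x. u (\<phi> k (\<phi> (group_commutator G h g) x)) = u (\<phi> k x)"
    have comm: "u (\<phi> g (\<phi> h x)) = u (\<phi> h (\<phi> g x))" if h: "h \<in> carrier G" for h x
    proof -
      have "\<phi> h (\<phi> g x) = \<phi> (group_commutator G h g \<otimes> (g \<otimes> h)) x"
        using grp.group_commutator_swap[OF h g] g h by simp
      then show ?thesis
        using IH[OF h, rule_format, of \<one> "\<phi> g (\<phi> h x)"] g h by simp
    qed
    have "u (\<phi> g x) = u x" for x
    proof (rule antisym)
      show "u (\<phi> g x) \<le> u x"
        by (rule bounded_translate_le[OF f \<gamma> u g comm])
      \<comment> \<open>The hypotheses are symmetric under \<open>u \<mapsto> - u\<close>, which
        gives the reverse inequality.\<close>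
      have "- u (\<phi> g x) \<le> - u x"
      proof (rule bounded_translate_le[OF f \<gamma> _ _ g])
        show "(\<lambda>x. - u x * f x) \<in> L"
          using scale[OF u(1), of "-1"] by simp
      qed (use u(2) comm in auto)
      then show "u x \<le> u (\<phi> g x)"
        by simp
    qed
    then show "\<forall>h\<in>carrier G. \<forall>x. u (\<phi> h (\<phi> g x)) = u (\<phi> h x)"
      using comm by metis
  qed simp
  obtain V where V: "finite V" "V \<noteq> {}" "\<And>x. \<exists>g\<in>carrier G. \<exists>v\<in>V. x = \<phi> g v"
    using fundamental_domain by metis
  define M where "M = Max (u ` V)"
  have uM: "u x \<le> M" for x
  proof -
    obtain g v where "g \<in> carrier G" "v \<in> V" "x = \<phi> g v"
      using V(3) by blast
    then show ?thesis
      using inv[of g, rule_format, of \<one> v] V(1) by (simp add: M_def)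
  qed
  have "M \<in> u ` V"
    unfolding M_def using V by (intro Max_in) auto
  then obtain v where v: "u v = M"
    by blast
  have "(\<lambda>x. (M - u x) * f x) \<in> L"
    using lincomb[OF f(1) u(1), of M "-1"] by (simp add: algebra_simps)
  then have "(M - u x) * f x = 0" for x
    by (rule zero_everywhere[where x = v]) (auto simp: uM v f(2) less_imp_le)
  then have "u x = M" for x
    using f(2)[of x] by (metis eq_iff_diff_eq_0 less_irrefl mult_eq_0_iff)
  then show ?thesis
    by simp
qed

text \<open>A convex summand \<open>p\<close> satisfies \<open>t * p x \<le> f x\<close>, so
  \<open>p / f\<close> is bounded and hence constant; the value at \<open>x0\<close> then forces
  \<open>p = f\<close>.\<close>

lemma multiplicative_imp_extreme:
  assumes nil: "nilpotent_group G"
    and f: "f \<in> L" "\<And>x. f x \<ge> 0" "f x0 = 1"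
    and mult: "multiplicative G \<phi> f"
  shows "extreme_point_fun f {f \<in> L. (\<forall>x. f x \<ge> 0) \<and> f x0 = 1}"
  unfolding extreme_point_fun_def
proof (intro conjI ballI allI impI notI)
  show "f \<in> {f \<in> L. (\<forall>x. f x \<ge> 0) \<and> f x0 = 1}"
    using f by simp
next
  fix p q and t :: real
  assume p: "p \<in> {f \<in> L. (\<forall>x. f x \<ge> 0) \<and> f x0 = 1}" and q: "q \<in> {f \<in> L. (\<forall>x. f x \<ge> 0) \<and> f x0 = 1}"
    and t: "p \<noteq> q \<and> 0 < t \<and> t < 1" and eq: "f = (\<lambda>x. t * p x + (1 - t) * q x)"
  have pos: "f x > 0" for x
    using pos_everywhere[of f x0] f by simp
  obtain \<gamma> where \<gamma>: "\<And>g. g \<in> carrier G \<Longrightarrow> \<gamma> g > 0"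
    "\<And>g. g \<in> carrier G \<Longrightarrow> Tact G \<phi> g f = (\<lambda>x. \<gamma> (inv g) * f x)"
    using mult unfolding multiplicative_def by blast
  \<comment> \<open>\<open>Tact\<close> acts through inverses, so it is evaluated at
    \<open>inv g\<close>.\<close>
  have \<gamma>': "f (\<phi> g x) = \<gamma> g * f x" if "g \<in> carrier G" for g x
    using fun_cong[OF \<gamma>(2)[of "inv g"], of x] that by (simp add: Tact_def)
  have "p x / f x = p x0 / f x0" for x
  proof (rule bounded_imp_constant[OF nil f(1) pos \<gamma>(1) \<gamma>', where B = "1 / t" and u = "\<lambda>x. p x / f x"])
    have "(\<lambda>x. p x / f x * f x) = p"
      using less_imp_neq[OF pos] by (auto simp: fun_eq_iff)
    then show "(\<lambda>x. p x / f x * f x) \<in> L"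
      using p by simp
    show "\<bar>p x / f x\<bar> \<le> 1 / t" for x
    proof -
      have "t * p x \<le> f x"
        using eq t q by simp
      then show ?thesis
        using t p pos[of x] by (simp add: field_simps)
    qed
  qed auto
  then have "p x = f x" for x
    using p f(3) pos[of x] by (simp add: field_simps)
  moreover have "q x = p x" for x
  proof -
    have "(1 - t) * q x = (1 - t) * p x"
      using fun_cong[OF eq, of x] \<open>p x = f x\<close> by (simp add: algebra_simps)
    then show ?thesis
      using t by simp
  qed
  ultimately show False
    using t by auto
qed

end

section \<open>Harmonic functions on locally finite connected graphs\<close>

definition harmonic_functions :: "('x \<Rightarrow> 'x \<Rightarrow> real) \<Rightarrow> ('x \<Rightarrow> real) \<Rightarrow> ('x \<Rightarrow> real) set" where
  "harmonic_functions b c = {f. harmonic b c f}"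

lemma
  assumes "graph b c" and "locally_finite_graph b"
  shows domH_locally_finite: "domH b = UNIV"
    and Hop_locally_finite: "Hop b c f x = (\<Sum>y | b x y > 0. b x y * (f x - f y)) + c x * f x"
proof -
  have nz: "b x y = 0" if "\<not> b x y > 0" for x y
    using assms(1) that by (metis graph_def order_le_less)
  have fin: "finite {y. b x y > 0}" for x
    using assms(2) by (simp add: locally_finite_graph_def)
  have "(\<lambda>y. b x y * \<bar>f y\<bar>) summable_on UNIV" for f x
    by (rule finite_nonzero_values_imp_summable_on, rule finite_subset[OF _ fin[of x]]) (use nz in force)
  then show "domH b = UNIV"
    by (auto simp: domH_def)
  have "(\<Sum>\<^sub>\<infinity>y. b x y * (f x - f y)) = (\<Sum>\<^sub>\<infinity>y\<in>{y. b x y > 0}. b x y * (f x - f y))"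
    by (rule infsum_cong_neutral) (use nz in auto)
  then show "Hop b c f x = (\<Sum>y | b x y > 0. b x y * (f x - f y)) + c x * f x"
    using fin by (simp add: Hop_def)
qed

lemma harmonic_locally_finite:
  assumes "graph b c" and "locally_finite_graph b"
  shows "harmonic b c f \<longleftrightarrow> (\<forall>x. (\<Sum>y | b x y > 0. b x y * (f x - f y)) + c x * f x = 0)"
  by (simp add: harmonic_def domH_locally_finite[OF assms] fun_eq_iff Hop_locally_finite[OF assms])

text \<open>Harmonicity at \<open>x\<close> says that the weighted sum of \<open>f\<close> over the
  neighbours equals \<open>D * f x\<close>; by nonnegativity the single term at \<open>y\<close> is
  at most that.\<close>

lemma edge_harnack:
  assumes gr: "graph b c" and lf: "locally_finite_graph b" and "b x y > 0"
  shows "\<exists>C\<ge>0. \<forall>f. harmonic b c f \<longrightarrow> (\<forall>z. 0 \<le> f z) \<longrightarrow> f y \<le> C * f x"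
proof -
  define D where "D = (\<Sum>z | b x z > 0. b x z) + c x"
  \<comment> \<open>The potential \<open>c\<close> may be negative; the absolute value keeps the
    constant nonnegative.\<close>
  have "f y \<le> \<bar>D\<bar> / b x y * f x" if f: "harmonic b c f" "\<forall>z. 0 \<le> f z" for f
  proof -
    have fin: "finite {z. b x z > 0}"
      using lf by (simp add: locally_finite_graph_def)
    have "b x y * f y \<le> (\<Sum>z | b x z > 0. b x z * f z)"
      using fin assms(3) f(2) by (intro member_le_sum) auto
    also have "\<dots> = D * f x"
    proof -
      have "(\<Sum>z | b x z > 0. b x z * (f x - f z)) + c x * f x = 0"
        using f(1) harmonic_locally_finite[OF gr lf] by blast
      then show ?thesis
        by (simp add: D_def algebra_simps sum_subtractf sum_distrib_left)
    qed
    also have "\<dots> \<le> \<bar>D\<bar> * f x"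
      using f(2) by (intro mult_right_mono) auto
    finally show ?thesis
      using assms(3) by (simp add: field_simps)
  qed
  moreover have "\<bar>D\<bar> / b x y \<ge> 0"
    using assms(3) by simp
  ultimately show ?thesis
    by blast
qed

text \<open>Edge constants multiply along a directed path from \<open>x\<close> to
  \<open>y\<close>.\<close>

lemma connected_graph_harnack:
  assumes gr: "graph b c" and lf: "locally_finite_graph b" and "connected_graph b"
  shows "\<exists>C\<ge>0. \<forall>f. harmonic b c f \<longrightarrow> (\<forall>z. 0 \<le> f z) \<longrightarrow> f y \<le> C * f x"
proof -
  have "(\<lambda>u v. b u v > 0)\<^sup>*\<^sup>* x y"
    using assms(3) by (simp add: connected_graph_def)
  then show ?thesis
  proof induction
    case base
    show ?case
      by (intro exI[of _ 1]) simp
  next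
    case (step y z)
    obtain C where C: "C \<ge> 0" "\<And>f. harmonic b c f \<Longrightarrow> \<forall>z. 0 \<le> f z \<Longrightarrow> f y \<le> C * f x"
      using step.IH by blast
    obtain D where D: "D \<ge> 0" "\<And>f. harmonic b c f \<Longrightarrow> \<forall>z. 0 \<le> f z \<Longrightarrow> f z \<le> D * f y"
      using edge_harnack[OF gr lf step.hyps(2)] by blast
    have "f z \<le> (D * C) * f x" if "harmonic b c f" "\<forall>z. 0 \<le> f z" for f
      using D(2)[OF that] mult_left_mono[OF C(2)[OF that] D(1)] by (simp add: mult.assoc)
    then show ?case
      using C(1) D(1) by (intro exI[of _ "D * C"]) simp
  qed
qed

text \<open>Local finiteness turns harmonicity into finite linear equations, which survive linear
  combinations and pointwise limits.\<close>

lemma harnack_space_harmonic: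
  fixes b :: "'x::countable \<Rightarrow> 'x \<Rightarrow> real"
  assumes gr: "graph b c" and lf: "locally_finite_graph b" and conn: "connected_graph b"
    and act: "group_action G UNIV \<phi>" and coc: "cocompact_action G \<phi>" and inv: "G_invariant G \<phi> b c"
  shows "harnack_space G \<phi> (harmonic_functions b c)"
proof -
  interpret group_action G UNIV \<phi> by fact
  interpret group G
    using group_hom group_hom.axioms(1) by blast
  note harm = harmonic_locally_finite[OF gr lf]
  show ?thesis
  proof unfold_locales
    fix f g and s t :: real
    assume f: "f \<in> harmonic_functions b c" and g: "g \<in> harmonic_functions b c"
    have "(\<Sum>y | b x y > 0. b x y * ((s * f x + t * g x) - (s * f y + t * g y))) + c x * (s * f x + t * g x)
        = s * ((\<Sum>y | b x y > 0. b x y * (f x - f y)) + c x * f x)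
        + t * ((\<Sum>y | b x y > 0. b x y * (g x - g y)) + c x * g x)" for x
      by (simp add: sum_distrib_left distrib_left sum.distrib[symmetric])
        (simp add: algebra_simps sum.distrib[symmetric])
    then show "(\<lambda>x. s * f x + t * g x) \<in> harmonic_functions b c"
      using f g by (simp add: harmonic_functions_def harm)
  next
    fix F f
    assume F: "\<And>n::nat. F n \<in> harmonic_functions b c" "\<And>x. (\<lambda>n. F n x) \<longlonglongrightarrow> f x"
    have "(\<Sum>y | b x y > 0. b x y * (f x - f y)) + c x * f x = 0" for x
    proof (rule LIMSEQ_unique)
      show "(\<lambda>n. (\<Sum>y | b x y > 0. b x y * (F n x - F n y)) + c x * F n x)
          \<longlonglongrightarrow> (\<Sum>y | b x y > 0. b x y * (f x - f y)) + c x * f x"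
        by (intro tendsto_intros F)
      show "(\<lambda>n. (\<Sum>y | b x y > 0. b x y * (F n x - F n y)) + c x * F n x) \<longlonglongrightarrow> 0"
        using F(1) by (simp add: harmonic_functions_def harm)
    qed
    then show "f \<in> harmonic_functions b c"
      by (simp add: harmonic_functions_def harm)
  next
    fix g f assume g: "g \<in> carrier G" and f: "f \<in> harmonic_functions b c"
    \<comment> \<open>Composition with the action of \<open>g\<close> is \<open>Tact\<close> at the
      inverse of \<open>g\<close>.\<close>
    have "Hop b c (Tact G \<phi> (inv\<^bsub>G\<^esub> g) f) = Tact G \<phi> (inv\<^bsub>G\<^esub> g) (Hop b c f)"
      using inv g f by (simp add: G_invariant_def harmonic_functions_def harmonic_def)
    then show "(\<lambda>x. f (\<phi> g x)) \<in> harmonic_functions b c"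
      using f g by (simp add: harmonic_functions_def harmonic_def domH_locally_finite[OF gr lf] Tact_def)
  next
    fix x y
    show "\<exists>C. \<forall>f\<in>harmonic_functions b c. (\<forall>z. 0 \<le> f z) \<longrightarrow> f y \<le> C * f x"
      using connected_graph_harnack[OF gr lf conn, of y x] by (auto simp: harmonic_functions_def)
  qed (rule coc)
qed

section \<open>The normalized set is its own closure, and the two inclusions combine\<close>

text \<open>Over a countable set the product topology is first countable, so sequences suffice, and
  convergence there is pointwise.\<close>

lemma (in harnack_space) closed_normalized: "closed {f \<in> L. (\<forall>x. f x \<ge> 0) \<and> f x0 = 1}"
  unfolding closed_sequential_limits
proof (intro allI impI)
  fix F f assume F: "(\<forall>n. F n \<in> {f \<in> L. (\<forall>x. f x \<ge> 0) \<and> f x0 = 1}) \<and> F \<longlonglongrightarrow> f"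
  have lim: "(\<lambda>n. F n x) \<longlonglongrightarrow> f x" for x
    using F continuous_on_tendsto_compose[OF continuous_on_product_coordinates[of x], of F f sequentially]
    by auto
  have "f \<in> L"
    by (rule pointwise_limit[OF _ lim]) (use F in blast)
  moreover have "f x \<ge> 0" for x
    using lim[of x] by (rule LIMSEQ_le_const) (use F in auto)
  moreover have "f x0 = 1"
    using lim[of x0] F by (simp add: LIMSEQ_const_iff)
  ultimately show "f \<in> {f \<in> L. (\<forall>x. f x \<ge> 0) \<and> f x0 = 1}"
    by simp
qed

theorem theorem2:
  fixes b :: "'x::countable \<Rightarrow> 'x \<Rightarrow> real" and c :: "'x \<Rightarrow> real"
    and G :: "('g, 'm) monoid_scheme" and \<phi> :: "'g \<Rightarrow> 'x \<Rightarrow> 'x" and x0 :: 'x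
  assumes "graph b c" and "locally_finite_graph b" and "connected_graph b"
    and "nilpotent_group G" and "group_action G UNIV \<phi>"
    and "cocompact_action G \<phi>" and "G_invariant G \<phi> b c"
  shows "{f \<in> closure {f \<in> posharm b c. f x0 = 1}. multiplicative G \<phi> f}
       = {f. extreme_point_fun f (closure {f \<in> posharm b c. f x0 = 1})}"
proof -
  interpret harnack_space G \<phi> "harmonic_functions b c"
    by (rule harnack_space_harmonic) fact+
  let ?K = "{f \<in> harmonic_functions b c. (\<forall>x. f x \<ge> 0) \<and> f x0 = 1}"
  \<comment> \<open>The normalization at \<open>x0\<close> already excludes the zero
    function.\<close>
  have "{f \<in> posharm b c. f x0 = 1} = ?K"
    by (auto simp: posharm_def harmonic_functions_def)
  then have K: "closure {f \<in> posharm b c. f x0 = 1} = ?K"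
    using closed_normalized[of x0] by simp
  have "f \<in> ?K \<and> multiplicative G \<phi> f \<longleftrightarrow> extreme_point_fun f ?K" for f
  proof
    assume "f \<in> ?K \<and> multiplicative G \<phi> f"
    then show "extreme_point_fun f ?K"
      using multiplicative_imp_extreme[OF assms(4)] by blast
  next
    assume ext: "extreme_point_fun f ?K"
    then show "f \<in> ?K \<and> multiplicative G \<phi> f"
      using extreme_imp_multiplicative[OF assms(4) ext] unfolding extreme_point_fun_def by blast
  qed
  then show ?thesis
    unfolding K by blast
qed

end
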